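(* Let $W$ be a Coxeter group of type $A_1$, with single generator $s_1$, and let $\phi$ be its Vogan representation. Then the orbits of $F_2$ under the action of $\phi(W)$ are $\{0\}$ and $\{1\}$; $\mathrm{Ker}\,\phi=\{1,s_1\}=W=Z(W)$; and $\phi$ is irreducible.
   Context: For a simply-laced Coxeter group $W$ with finite generating set $S$, $|S|=n$, and defining relations $(ss')^{m(s,s')}=1$ ($m(s,s)=1$, $m(s,s')=m(s',s)\in\{2,3\}$ for $s\ne s'$), the Coxeter graph has vertex set $S$ and edge set $R=\{ss': m(s,s')=3\}$. For $s\in S$, $\mathbf{s}\in \mathrm{GL}_n(F_2)$ is the matrix with rows and columns indexed by $S$ and entries $\mathbf{s}_{uv}=1$ if $u=v$, or if $v=s$ and $uv\in R$, and $0$ otherwise. The Vogan representation of $W$ is the homomorphism $\phi:W\to \mathrm{GL}_n(F_2)$ with $\phi(s)=\mathbf{s}$ for $s\in S$; $\phi(W)$ acts on the column vectors $F_2^n$ by left multiplication. Type $A_1$ means $S=\{s_1\}$ (one vertex, no edges), so $W=\langle s_1 : s_1^2=1\rangle$ and $n=1$. $\phi$ is irreducible if there is no subspace $V\subseteq F_2^n$ with $V\neq 0$, $V\neq F_2^n$ and $\phi(W)V\subseteq V$. $Z(W)$ denotes the center of $W$. *)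

theory Defs
  imports "HOL-Analysis.Cartesian_Space" "HOL-Algebra.Group_Action" "HOL-Algebra.Generated_Groups" "HOL-Library.Z2"
begin

subsection \<open>Groups given by generators and relations\<close>

text \<open>A word is a list of letters; the letter \<open>(s, True)\<close> stands for the generator \<open>s\<close> and
  \<open>(s, False)\<close> for its formal inverse.\<close>

type_synonym 's gword = "('s \<times> bool) list"

primrec word_eval :: "('w, 'b) monoid_scheme \<Rightarrow> ('s \<Rightarrow> 'w) \<Rightarrow> 's gword \<Rightarrow> 'w" where
  "word_eval G \<sigma> [] = \<one>\<^bsub>G\<^esub>"
| "word_eval G \<sigma> (l # w) =
     (if snd l then \<sigma> (fst l) else inv\<^bsub>G\<^esub> (\<sigma> (fst l))) \<otimes>\<^bsub>G\<^esub> word_eval G \<sigma> w"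

text \<open>Equality of words in the group with relations \<open>r = 1\<close>, \<open>r \<in> R\<close>: the least congruence
  that contains free cancellation and the relations.\<close>

inductive word_equiv :: "'s gword set \<Rightarrow> 's gword \<Rightarrow> 's gword \<Rightarrow> bool" for R where
  refl: "word_equiv R w w"
| sym: "word_equiv R w w' \<Longrightarrow> word_equiv R w' w"
| trans: "word_equiv R w w' \<Longrightarrow> word_equiv R w' w'' \<Longrightarrow> word_equiv R w w''"
| cancel: "word_equiv R (u @ [(s, b), (s, \<not> b)] @ v) (u @ v)"
| relation: "r \<in> R \<Longrightarrow> word_equiv R (u @ r @ v) (u @ v)"

text \<open>The group \<open>G\<close> is presented by the generators \<open>\<sigma> s\<close> and the relations \<open>r = 1\<close>, \<open>r \<in> R\<close>:
  evaluation of words induces an isomorphism from the group of words modulo \<^const>\<open>word_equiv\<close>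
  onto \<open>G\<close>.\<close>

definition presented_group :: "('w, 'b) monoid_scheme \<Rightarrow> ('s \<Rightarrow> 'w) \<Rightarrow> 's gword set \<Rightarrow> bool" where
  "presented_group G \<sigma> R \<longleftrightarrow>
     group G \<and> range \<sigma> \<subseteq> carrier G \<and> generate G (range \<sigma>) = carrier G \<and>
     (\<forall>w w'. word_eval G \<sigma> w = word_eval G \<sigma> w' \<longleftrightarrow> word_equiv R w w')"


subsection \<open>Simply-laced Coxeter groups\<close>

text \<open>The index set \<open>S\<close> of the generators is the universe of a finite type \<open>'s\<close>, so that
  \<open>n = CARD('s)\<close> and the space of column vectors is \<open>bit ^ 's\<close>; the generator of \<open>W\<close>
  belonging to \<open>s\<close> is \<open>\<sigma> s\<close>.\<close>

definition simply_laced :: "('s \<Rightarrow> 's \<Rightarrow> nat) \<Rightarrow> bool" where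
  "simply_laced m \<longleftrightarrow>
     (\<forall>s. m s s = 1) \<and> (\<forall>s t. m s t = m t s) \<and> (\<forall>s t. s \<noteq> t \<longrightarrow> m s t \<in> {2, 3})"

definition coxeter_relators :: "('s \<Rightarrow> 's \<Rightarrow> nat) \<Rightarrow> 's gword set" where
  "coxeter_relators m = {concat (replicate (m s t) [(s, True), (t, True)]) | s t. True}"

definition simply_laced_coxeter_group ::
  "('w, 'b) monoid_scheme \<Rightarrow> ('s::finite \<Rightarrow> 'w) \<Rightarrow> ('s \<Rightarrow> 's \<Rightarrow> nat) \<Rightarrow> bool" where
  "simply_laced_coxeter_group W \<sigma> m \<longleftrightarrow>
     simply_laced m \<and> presented_group W \<sigma> (coxeter_relators m)"

definition coxeter_edges :: "('s \<Rightarrow> 's \<Rightarrow> nat) \<Rightarrow> 's set set" where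
  "coxeter_edges m = {{s, t} | s t. m s t = 3}"

definition coxeter_type_A1 ::
  "('w, 'b) monoid_scheme \<Rightarrow> ('s::finite \<Rightarrow> 'w) \<Rightarrow> ('s \<Rightarrow> 's \<Rightarrow> nat) \<Rightarrow> 's \<Rightarrow> bool" where
  "coxeter_type_A1 W \<sigma> m s\<^sub>1 \<longleftrightarrow>
     simply_laced_coxeter_group W \<sigma> m \<and> (UNIV :: 's set) = {s\<^sub>1} \<and> coxeter_edges m = {}"


subsection \<open>The Vogan representation\<close>

text \<open>The group of invertible matrices over \<open>F\<^sub>2\<close>, rows and columns indexed by \<open>'s\<close>; the
  2 in the name refers to the field, not to the size.\<close>

definition GL2 :: "(bit ^ 's::finite ^ 's) monoid" where
  "GL2 = \<lparr>carrier = {A. invertible A}, mult = (**), one = mat 1\<rparr>"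

definition vogan_matrix :: "('s \<Rightarrow> 's \<Rightarrow> nat) \<Rightarrow> 's \<Rightarrow> bit ^ 's::finite ^ 's" where
  "vogan_matrix m s = (\<chi> u v. if u = v \<or> (v = s \<and> {u, v} \<in> coxeter_edges m) then 1 else 0)"

definition vogan_representation ::
  "('w, 'b) monoid_scheme \<Rightarrow> ('s::finite \<Rightarrow> 'w) \<Rightarrow> ('s \<Rightarrow> 's \<Rightarrow> nat)
    \<Rightarrow> ('w \<Rightarrow> bit ^ 's ^ 's) \<Rightarrow> bool" where
  "vogan_representation W \<sigma> m \<phi> \<longleftrightarrow>
     \<phi> \<in> hom W GL2 \<and> (\<forall>s. \<phi> (\<sigma> s) = vogan_matrix m s)"

definition irreducible_rep :: "('w, 'b) monoid_scheme \<Rightarrow> ('w \<Rightarrow> bit ^ 's::finite ^ 's) \<Rightarrow> bool" where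
  "irreducible_rep W \<phi> \<longleftrightarrow>
     \<not> (\<exists>V. vec.subspace V \<and> V \<noteq> {0} \<and> V \<noteq> UNIV \<and> (\<forall>g \<in> carrier W. \<forall>x \<in> V. \<phi> g *v x \<in> V))"

definition image_group :: "('w, 'b) monoid_scheme \<Rightarrow> ('w \<Rightarrow> bit ^ 's::finite ^ 's)
    \<Rightarrow> (bit ^ 's ^ 's) monoid" where
  "image_group W \<phi> = GL2\<lparr>carrier := \<phi> ` carrier W\<rparr>"

definition group_center :: "('w, 'b) monoid_scheme \<Rightarrow> 'w set" where
  "group_center G = {z \<in> carrier G. \<forall>x \<in> carrier G. z \<otimes>\<^bsub>G\<^esub> x = x \<otimes>\<^bsub>G\<^esub> z}"


subsection \<open>Existence and uniqueness of the Vogan representation\<close>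

lemma group_GL2: "group (GL2 :: (bit ^ 's::finite ^ 's) monoid)"
proof (rule groupI)
  fix A :: "bit ^ 's ^ 's" assume "A \<in> carrier GL2"
  then obtain B where "A ** B = mat 1" "B ** A = mat 1"
    by (auto simp: GL2_def invertible_def)
  then show "\<exists>B\<in>carrier GL2. B \<otimes>\<^bsub>GL2\<^esub> A = \<one>\<^bsub>GL2\<^esub>"
    by (auto simp: GL2_def invertible_def)
qed (auto simp: GL2_def invertible_mult matrix_mul_assoc invertible_def[of "mat 1"]
      intro: exI[of _ "mat 1"])

lemma bit_double: "(x::bit) + (x + y) = y" "(x::bit) + x = 0"
  by (cases x; cases y; simp)+

lemma vogan_matrix_vec:
  assumes "simply_laced m"
  shows "vogan_matrix m s *v x = (\<chi> u. x $ u + (if m u s = 3 then x $ s else 0))"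
proof -
  have e: "{u, v} \<in> coxeter_edges m \<longleftrightarrow> m u v = 3" for u v
    using assms by (auto simp: coxeter_edges_def simply_laced_def doubleton_eq_iff)
  have ss: "m s s = 1" using assms by (simp add: simply_laced_def)
  have "(\<Sum>v\<in>UNIV. vogan_matrix m s $ u $ v * x $ v) = x $ u + (if m u s = 3 then x $ s else 0)" for u
  proof -
    have "(\<Sum>v\<in>UNIV. vogan_matrix m s $ u $ v * x $ v) =
      (\<Sum>v\<in>UNIV. (if v = u then x $ v else 0) + (if v = s then (if m u s = 3 then x $ s else 0) else 0))"
      using ss by (intro sum.cong) (auto simp: vogan_matrix_def e)
    also have "\<dots> = (\<Sum>v\<in>UNIV. if v = u then x $ v else 0)
        + (\<Sum>v\<in>UNIV. if v = s then (if m u s = 3 then x $ s else 0) else 0)"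
      by (rule sum.distrib)
    also have "\<dots> = x $ u + (if m u s = 3 then x $ s else 0)"
      unfolding sum.delta[OF finite_class.finite_UNIV] by simp
    finally show ?thesis .
  qed
  then show ?thesis by (simp add: matrix_vector_mult_def)
qed

lemma vogan_matrix_square:
  assumes "simply_laced m"
  shows "vogan_matrix m s ** vogan_matrix m s = mat 1"
  using assms
  by (auto simp: matrix_eq matrix_vector_mul_assoc[symmetric] vogan_matrix_vec vec_eq_iff
        simply_laced_def bit_double add.assoc)

lemma vogan_matrix_GL2: "simply_laced m \<Longrightarrow> vogan_matrix m s \<in> carrier GL2"
  using vogan_matrix_square[of m s] by (auto simp: GL2_def invertible_def)

lemma vogan_matrix_relator:
  assumes m: "simply_laced m" and r: "r \<in> coxeter_relators m"
  shows "word_eval GL2 (vogan_matrix m) r = \<one>\<^bsub>GL2\<^esub>"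
proof -
  obtain s t where r: "r = concat (replicate (m s t) [(s, True), (t, True)])"
    using r by (auto simp: coxeter_relators_def)
  have ss: "m s s = 1" "m t t = 1" "m t s = m s t" using m by (auto simp: simply_laced_def)
  consider "s = t" | "m s t = 2" | "m s t = 3" using m unfolding simply_laced_def by blast
  then show ?thesis
  proof cases
    case 1
    then show ?thesis using vogan_matrix_square[OF m] by (simp add: r ss GL2_def)
  next
    case 2
    have "word_eval GL2 (vogan_matrix m) r *v x = x" for x
      using ss 2
      by (cases "x $ s"; cases "x $ t";
          simp add: r GL2_def numeral_2_eq_2 matrix_vector_mul_assoc[symmetric]
          vogan_matrix_vec[OF m] vec_eq_iff bit_double add.commute add.left_commute)
    then show ?thesis by (simp add: matrix_eq GL2_def)
  next
    case 3
    have "word_eval GL2 (vogan_matrix m) r *v x = x" for x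
      using ss 3
      by (cases "x $ s"; cases "x $ t";
          simp add: r GL2_def numeral_3_eq_3 matrix_vector_mul_assoc[symmetric]
          vogan_matrix_vec[OF m] vec_eq_iff bit_double add.commute add.left_commute)
    then show ?thesis by (simp add: matrix_eq GL2_def)
  qed
qed

lemma word_eval_closed:
  assumes "group G" "range \<sigma> \<subseteq> carrier G"
  shows "word_eval G \<sigma> w \<in> carrier G"
proof -
  interpret group G by fact
  have "\<sigma> s \<in> carrier G" for s using assms by auto
  then show ?thesis by (induction w) auto
qed

lemma word_eval_append:
  assumes "group G" "range \<sigma> \<subseteq> carrier G"
  shows "word_eval G \<sigma> (u @ v) = word_eval G \<sigma> u \<otimes>\<^bsub>G\<^esub> word_eval G \<sigma> v"
proof (induction u)
  case Nil
  then show ?case using assms by (simp add: word_eval_closed group.is_monoid)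
next
  case (Cons l u)
  have "\<sigma> (fst l) \<in> carrier G" using assms by auto
  then have "(if snd l then \<sigma> (fst l) else inv\<^bsub>G\<^esub> (\<sigma> (fst l))) \<in> carrier G"
    using assms by (simp add: group.inv_closed)
  then show ?case using assms Cons
    by (simp add: monoid.m_assoc group.is_monoid word_eval_closed)
qed

lemma word_eval_respects:
  assumes "group G" "range \<sigma> \<subseteq> carrier G" "\<And>r. r \<in> R \<Longrightarrow> word_eval G \<sigma> r = \<one>\<^bsub>G\<^esub>"
    and "word_equiv R w w'"
  shows "word_eval G \<sigma> w = word_eval G \<sigma> w'"
  using assms(4)
proof induction
  case (cancel u s b v)
  have "\<sigma> s \<in> carrier G" using assms by auto
  then have "word_eval G \<sigma> [(s, b), (s, \<not> b)] = \<one>\<^bsub>G\<^esub>"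
    using assms by (simp add: group.l_inv group.r_inv group.is_monoid group.inv_closed)
  then show ?case using assms(1,2)
    by (simp only: word_eval_append word_eval_closed monoid.l_one group.is_monoid)
next
  case (relation r u v)
  then show ?case using assms
    by (simp add: word_eval_append word_eval_closed group.is_monoid)
qed auto

lemma word_eval_surj:
  assumes "group G" "range \<sigma> \<subseteq> carrier G" "g \<in> generate G (range \<sigma>)"
  shows "\<exists>w. word_eval G \<sigma> w = g"
  using assms(3)
proof induction
  case one
  show ?case by (rule exI[of _ "[]"]) simp
next
  case (incl h)
  then obtain s where "h = \<sigma> s" "h \<in> carrier G" using assms by auto
  then show ?case using assms(1)
    by (intro exI[of _ "[(s, True)]"]) (simp add: group.is_monoid monoid.r_one)
next
  case (inv h)
  then obtain s where "h = \<sigma> s" "h \<in> carrier G" using assms by auto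
  then show ?case using assms(1)
    by (intro exI[of _ "[(s, False)]"]) (simp add: group.is_monoid monoid.r_one group.inv_closed)
next
  case (eng h1 h2)
  then show ?case using word_eval_append[OF assms(1,2)] by metis
qed

lemma vogan_representation_exists:
  assumes "simply_laced_coxeter_group W \<sigma> m"
  shows "\<exists>\<phi>. vogan_representation W \<sigma> m \<phi>"
proof -
  have m: "simply_laced m" and W: "group W" "range \<sigma> \<subseteq> carrier W"
    and gen: "generate W (range \<sigma>) = carrier W"
    and eq: "\<And>w w'. word_eval W \<sigma> w = word_eval W \<sigma> w' \<longleftrightarrow> word_equiv (coxeter_relators m) w w'"
    using assms by (auto simp: simply_laced_coxeter_group_def presented_group_def)
  have V: "range (vogan_matrix m) \<subseteq> carrier GL2" using vogan_matrix_GL2[OF m] by auto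
  define \<phi> where "\<phi> g = word_eval GL2 (vogan_matrix m) (SOME w. word_eval W \<sigma> w = g)" for g
  have \<phi>: "\<phi> (word_eval W \<sigma> w) = word_eval GL2 (vogan_matrix m) w" for w
    unfolding \<phi>_def
    by (rule word_eval_respects[OF group_GL2 V vogan_matrix_relator[OF m]])
       (auto simp: eq[symmetric] intro: someI)
  have surj: "\<exists>w. g = word_eval W \<sigma> w" if "g \<in> carrier W" for g
    using word_eval_surj[OF W] that gen by metis
  have "\<phi> \<in> hom W GL2"
  proof (rule homI)
    fix g assume "g \<in> carrier W"
    then show "\<phi> g \<in> carrier GL2" using surj \<phi> word_eval_closed[OF group_GL2 V] by metis
  next
    fix g h assume "g \<in> carrier W" "h \<in> carrier W"
    then show "\<phi> (g \<otimes>\<^bsub>W\<^esub> h) = \<phi> g \<otimes>\<^bsub>GL2\<^esub> \<phi> h"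
      using surj \<phi> word_eval_append[OF group_GL2 V] word_eval_append[OF W] by metis
  qed
  moreover have "\<phi> (\<sigma> s) = vogan_matrix m s" for s
  proof -
    have "\<sigma> s \<in> carrier W" using W by auto
    then show ?thesis
      using \<phi>[of "[(s, True)]"] W vogan_matrix_GL2[OF m]
      by (simp add: monoid.r_one group.is_monoid monoid.r_one[OF group.is_monoid[OF group_GL2]])
  qed
  ultimately show ?thesis by (auto simp: vogan_representation_def)
qed

lemma vogan_representation_unique:
  assumes W: "simply_laced_coxeter_group W \<sigma> m"
    and "vogan_representation W \<sigma> m \<phi>" "vogan_representation W \<sigma> m \<psi>" "g \<in> carrier W"
  shows "\<phi> g = \<psi> g"
proof -
  have G: "group W" "range \<sigma> \<subseteq> carrier W" "g \<in> generate W (range \<sigma>)"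
    using assms by (auto simp: simply_laced_coxeter_group_def presented_group_def)
  have "group_hom W GL2 \<phi>" "group_hom W GL2 \<psi>"
    using assms G(1) group_GL2
    by (auto simp: vogan_representation_def group_hom_def group_hom_axioms_def)
  note h = this group_hom.hom_one group_hom.hom_inv group_hom.hom_mult
  have agree: "\<phi> (\<sigma> s) = \<psi> (\<sigma> s)" for s using assms by (simp add: vogan_representation_def)
  have "\<phi> (word_eval W \<sigma> w) = \<psi> (word_eval W \<sigma> w)" for w
  proof (induction w)
    case Nil
    then show ?case using h(1,2) by (simp add: group_hom.hom_one)
  next
    case (Cons l w)
    have "\<sigma> (fst l) \<in> carrier W" using G by auto
    then show ?case using Cons agree h(1,2) G(1) word_eval_closed[OF G(1,2)]
      by (simp add: group_hom.hom_mult group_hom.hom_inv group.inv_closed)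
  qed
  then show ?thesis using word_eval_surj[OF G] by metis
qed

end

theory Submission
  imports Defs
begin

text \<open>The single relator is the square of the generator, so the generator is its own inverse
  and generates nothing beyond itself and the identity (\<open>type_A1_carrier\<close>); such a
  group is commutative and equals its center. The Coxeter graph has no edges, so the Vogan matrix of
  the generator is the identity and \<open>\<phi>\<close> is trivial
  (\<open>type_A1_vogan_trivial\<close>). Hence the kernel is all of the group and every orbit is a
  singleton. The space has only the vectors 0 and 1 (\<open>bit_vec_one_dim_cases\<close>), which
  lists the orbits and leaves no room for a proper nonzero subspace.\<close>

lemma type_A1_carrier:
  fixes \<sigma> :: "'s::finite \<Rightarrow> 'w"
  assumes "coxeter_type_A1 W \<sigma> m s\<^sub>1"
  shows "carrier W = {\<one>\<^bsub>W\<^esub>, \<sigma> s\<^sub>1}"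
proof -
  have U: "(UNIV :: 's set) = {s\<^sub>1}" and m: "m s\<^sub>1 s\<^sub>1 = 1"
    and P: "presented_group W \<sigma> (coxeter_relators m)"
    using assms
    by (simp_all add: coxeter_type_A1_def simply_laced_coxeter_group_def simply_laced_def)
  interpret group W using P by (simp add: presented_group_def)
  have r: "range \<sigma> = {\<sigma> s\<^sub>1}" by (simp add: U)
  have c: "\<sigma> s\<^sub>1 \<in> carrier W" using P by (auto simp: presented_group_def)
  have "concat (replicate (m s\<^sub>1 s\<^sub>1) [(s\<^sub>1, True), (s\<^sub>1, True)]) \<in> coxeter_relators m"
    unfolding coxeter_relators_def by blast
  \<comment> \<open>The empty words supply the context \<open>u @ r @ v\<close> in which the rule
    \<open>relation\<close> deletes a relator.\<close>
  then have "word_equiv (coxeter_relators m) ([] @ [(s\<^sub>1, True), (s\<^sub>1, True)] @ []) ([] @ [])"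
    by (intro word_equiv.relation) (simp add: m)
  then have "word_eval W \<sigma> [(s\<^sub>1, True), (s\<^sub>1, True)] = word_eval W \<sigma> []"
    using P unfolding presented_group_def append_Nil append_Nil2 by blast
  then have sq: "\<sigma> s\<^sub>1 \<otimes>\<^bsub>W\<^esub> \<sigma> s\<^sub>1 = \<one>\<^bsub>W\<^esub>" using c by simp
  then have inv: "inv\<^bsub>W\<^esub> \<sigma> s\<^sub>1 = \<sigma> s\<^sub>1" using c by (simp add: inv_equality)
  \<comment> \<open>The pair is closed under inverses by \<open>inv\<close> and under products by
    \<open>sq\<close>, so generation never leaves it.\<close>
  have "g \<in> {\<one>\<^bsub>W\<^esub>, \<sigma> s\<^sub>1}" if "g \<in> generate W {\<sigma> s\<^sub>1}" for g
    using that by induction (use inv sq c in auto)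
  moreover have "generate W {\<sigma> s\<^sub>1} = carrier W"
    using P by (simp add: presented_group_def r)
  ultimately show ?thesis using c by auto
qed

text \<open>Without edges only the diagonal entries of \<open>vogan_matrix\<close> survive, so the
  homomorphism sends both the identity and the generator to \<open>mat 1\<close>.\<close>

lemma type_A1_vogan_trivial:
  assumes A: "coxeter_type_A1 W \<sigma> m s\<^sub>1" and V: "vogan_representation W \<sigma> m \<phi>"
    and g: "g \<in> carrier W"
  shows "\<phi> g = mat 1"
proof -
  have h: "group_hom W GL2 \<phi>"
    using A V group_GL2
    by (auto simp: coxeter_type_A1_def simply_laced_coxeter_group_def presented_group_def
        vogan_representation_def group_hom_def group_hom_axioms_def)
  have "\<phi> (\<sigma> s\<^sub>1) = mat 1"
    using A V
    by (simp add: coxeter_type_A1_def vogan_representation_def vogan_matrix_def mat_def)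
  then show ?thesis
    using g group_hom.hom_one[OF h] by (auto simp: type_A1_carrier[OF A] GL2_def)
qed

text \<open>Here \<open>1\<close> is the vector with all entries 1. With a single index every vector
  is constant, hence fixed by one bit.\<close>

lemma bit_vec_one_dim_cases:
  fixes x :: "bit ^ 's::finite"
  assumes "(UNIV :: 's set) = {s}"
  shows "x = 0 \<or> x = 1"
proof -
  have "u = s" for u using assms by blast
  then have "x = (\<chi> u. x $ s)" by (metis vec_lambda_unique)
  then show ?thesis by (cases "x $ s") (auto simp: vec_eq_iff)
qed

theorem proposition5p1:
  fixes W :: "('w, 'b) monoid_scheme"
    and \<sigma> :: "'s::finite \<Rightarrow> 'w"
    and m :: "'s \<Rightarrow> 's \<Rightarrow> nat"
    and s\<^sub>1 :: 's
    and \<phi> :: "'w \<Rightarrow> bit ^ 's ^ 's"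
  assumes "coxeter_type_A1 W \<sigma> m s\<^sub>1"
    and "vogan_representation W \<sigma> m \<phi>"
  shows "orbits (image_group W \<phi>) UNIV (*v) = {{0}, {1}} \<and>
    kernel W GL2 \<phi> = {\<one>\<^bsub>W\<^esub>, \<sigma> s\<^sub>1} \<and>
    {\<one>\<^bsub>W\<^esub>, \<sigma> s\<^sub>1} = carrier W \<and>
    carrier W = group_center W \<and>
    irreducible_rep W \<phi>"
proof -
  note C = type_A1_carrier[OF assms(1)] and triv = type_A1_vogan_trivial[OF assms]
  have grp: "group W" and U: "(UNIV :: 's set) = {s\<^sub>1}"
    using assms(1)
    by (auto simp: coxeter_type_A1_def simply_laced_coxeter_group_def presented_group_def)
  interpret group W by (fact grp)
  note cases01 = bit_vec_one_dim_cases[OF U]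
  have "\<phi> ` carrier W = {mat 1}" using triv by force
  then have "orbit (image_group W \<phi>) (*v) x = {x}" for x
    by (simp add: orbit_def image_group_def)
  then have "orbits (image_group W \<phi>) UNIV (*v) = {{0}, {1}}"
    using cases01 by (auto simp: orbits_def)
  moreover have "kernel W GL2 \<phi> = carrier W"
    using triv by (auto simp: kernel_def GL2_def)
  \<comment> \<open>Of two elements of the pair, either both are equal or one is the identity, so
    they commute.\<close>
  moreover have "carrier W = group_center W"
    using C r_one l_one by (auto simp: group_center_def)
  moreover have "irreducible_rep W \<phi>"
  proof -
    have "V = UNIV" if V: "vec.subspace V" "V \<noteq> {0}" for V :: "(bit ^ 's) set"
    proof -
      \<comment> \<open>The subspace contains 0 and some nonzero vector; the latter can only be 1,
        so no vector is missing.\<close>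
      have "0 \<in> V" using V(1) by (rule vec.subspace_0)
      moreover from this obtain x where "x \<in> V" "x \<noteq> 0" using V(2) by blast
      ultimately show ?thesis using cases01 by (metis UNIV_eq_I)
    qed
    then show ?thesis unfolding irreducible_rep_def by blast
  qed
  ultimately show ?thesis using C by simp
qed

end
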